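(* Let $\mathcal{A}\in\mathbb{C}^{I_1\times\cdots\times I_N\times J_1\times\cdots\times J_N}$ and $\mathcal{B}\in\mathbb{C}^{J_1\times\cdots\times J_N\times I_1\times\cdots\times I_N}$. Then $(\mathcal{A}*_N\mathcal{B})^{\dagger}=\mathcal{B}^{\dagger}*_N\mathcal{A}^{\dagger}$ if and only if both the equations $$\mathcal{A}^{\dagger}*_N\mathcal{A}*_N\mathcal{B}=\mathcal{B}*_N(\mathcal{A}*_N\mathcal{B})^{\dagger}*_N\mathcal{A}*_N\mathcal{B}$$ and $$\mathcal{B}*_N\mathcal{B}^{\dagger}*_N\mathcal{A}^*=\mathcal{A}^**_N\mathcal{A}*_N\mathcal{B}*_N(\mathcal{A}*_N\mathcal{B})^{\dagger}$$ are satisfied.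
   Context: Tensors are complex multiway arrays, with entries of $\mathcal{A}\in\mathbb{C}^{I_1\times\cdots\times I_N\times J_1\times\cdots\times J_N}$ denoted $a_{i_1\ldots i_N j_1\ldots j_N}$. The Einstein product of $\mathcal{A}\in\mathbb{C}^{I_1\times\cdots\times I_N\times K_1\times\cdots\times K_N}$ and $\mathcal{B}\in\mathbb{C}^{K_1\times\cdots\times K_N\times J_1\times\cdots\times J_M}$ is the tensor $\mathcal{A}*_N\mathcal{B}\in\mathbb{C}^{I_1\times\cdots\times I_N\times J_1\times\cdots\times J_M}$ with $(\mathcal{A}*_N\mathcal{B})_{i_1\ldots i_N j_1\ldots j_M}=\sum_{k_1\ldots k_N}a_{i_1\ldots i_N k_1\ldots k_N}b_{k_1\ldots k_N j_1\ldots j_M}$; it is associative. The conjugate transpose $\mathcal{A}^*\in\mathbb{C}^{J_1\times\cdots\times J_N\times I_1\times\cdots\times I_N}$ has entries $(\mathcal{A}^* )_{j_1\ldots j_N i_1\ldots i_N}=\overline{a_{i_1\ldots i_N j_1\ldots j_N}}$. The Moore-Penrose inverse $\mathcal{A}^{\dagger}$ of $\mathcal{A}\in\mathbb{C}^{I_1\times\cdots\times I_N\times J_1\times\cdots\times J_N}$ is the unique tensor $\mathcal{X}\in\mathbb{C}^{J_1\times\cdots\times J_N\times I_1\times\cdots\times I_N}$ (it always exists) satisfying (1) $\mathcal{A}*_N\mathcal{X}*_N\mathcal{A}=\mathcal{A}$; (2) $\mathcal{X}*_N\mathcal{A}*_N\mathcal{X}=\mathcal{X}$; (3) $(\mathcal{A}*_N\mathcal{X})^*=\mathcal{A}*_N\mathcal{X}$;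 (4) $(\mathcal{X}*_N\mathcal{A})^*=\mathcal{X}*_N\mathcal{A}$. *)

theory Defs
  imports Complex_Main
begin

text \<open>A tensor carries the list of its mode dimensions, so that its order and its dimensions are
  ordinary values. Multi-indices are lists of naturals, counted from 0 in every mode.\<close>

definition multi_indices :: "nat list \<Rightarrow> nat list set" where
  "multi_indices ds = {ix. list_all2 (<) ix ds}"

text \<open>Entries outside the index range are normalised to 0; hence equality of tensors means equal
  dimensions and equal entries within the range.\<close>

typedef tensor = "{(ds :: nat list, f :: nat list \<Rightarrow> complex). \<forall>ix. ix \<notin> multi_indices ds \<longrightarrow> f ix = 0}"
  by (rule exI[of _ "([], \<lambda>_. 0)"]) simp

setup_lifting type_definition_tensor

lift_definition dims :: "tensor \<Rightarrow> nat list" is fst .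

lift_definition entry :: "tensor \<Rightarrow> nat list \<Rightarrow> complex" is snd .

lift_definition mk_tensor :: "nat list \<Rightarrow> (nat list \<Rightarrow> complex) \<Rightarrow> tensor" is
  "\<lambda>ds f. (ds, \<lambda>ix. if ix \<in> multi_indices ds then f ix else 0)"
  by simp

definition carrier_tensor :: "nat list \<Rightarrow> tensor set" where
  "carrier_tensor ds = {A. dims A = ds}"

text \<open>The last \<open>N\<close> modes of \<open>A\<close> are contracted with the first \<open>N\<close> modes of \<open>B\<close>; this is
  meaningful only if the dimensions of these modes agree.\<close>

definition einstein_product :: "tensor \<Rightarrow> nat \<Rightarrow> tensor \<Rightarrow> tensor"
    ("(_/ \<star>\<^bsub>_\<^esub> _)" [70, 0, 71] 70) where
  "A \<star>\<^bsub>N\<^esub> B =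
    (let m = length (dims A) - N in
      mk_tensor (take m (dims A) @ drop N (dims B))
        (\<lambda>ix. \<Sum>k\<in>multi_indices (drop m (dims A)).
           entry A (take m ix @ k) * entry B (k @ drop m ix)))"

text \<open>The following two notions are meant for tensors of order \<open>2 * N\<close>, read as having \<open>N\<close> row
  modes followed by \<open>N\<close> column modes.\<close>

definition conj_transpose :: "nat \<Rightarrow> tensor \<Rightarrow> tensor" where
  "conj_transpose N A =
    mk_tensor (drop N (dims A) @ take N (dims A)) (\<lambda>ix. cnj (entry A (drop N ix @ take N ix)))"

definition is_MP_inverse :: "nat \<Rightarrow> tensor \<Rightarrow> tensor \<Rightarrow> bool" where
  "is_MP_inverse N A X \<longleftrightarrow>
    X \<in> carrier_tensor (drop N (dims A) @ take N (dims A)) \<and>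
    A \<star>\<^bsub>N\<^esub> X \<star>\<^bsub>N\<^esub> A = A \<and>
    X \<star>\<^bsub>N\<^esub> A \<star>\<^bsub>N\<^esub> X = X \<and>
    conj_transpose N (A \<star>\<^bsub>N\<^esub> X) = A \<star>\<^bsub>N\<^esub> X \<and>
    conj_transpose N (X \<star>\<^bsub>N\<^esub> A) = X \<star>\<^bsub>N\<^esub> A"

definition MP_inverse :: "nat \<Rightarrow> tensor \<Rightarrow> tensor" where
  "MP_inverse N A = (THE X. is_MP_inverse N A X)"

lemma dims_mk_tensor [simp]: "dims (mk_tensor ds f) = ds"
  by transfer simp

lemma entry_mk_tensor:
  "entry (mk_tensor ds f) ix = (if ix \<in> multi_indices ds then f ix else 0)"
  by transfer simp

lemma tensor_eqI:
  assumes "dims A = dims B" "\<And>ix. ix \<in> multi_indices (dims A) \<Longrightarrow> entry A ix = entry B ix"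
  shows "A = B"
  using assms by transfer (auto simp: fun_eq_iff, metis)

lemma length_multi_indices: "ix \<in> multi_indices ds \<Longrightarrow> length ix = length ds"
  by (simp add: multi_indices_def list_all2_lengthD)

lemma append_in_multi_indices:
  assumes "i \<in> multi_indices Is" "j \<in> multi_indices Js"
  shows "i @ j \<in> multi_indices (Is @ Js)"
  using assms by (simp add: multi_indices_def list_all2_appendI)

lemma einstein_product_carrier:
  assumes "A \<in> carrier_tensor (Is @ Ks)" "B \<in> carrier_tensor (Ks @ Js)" "length Ks = N"
  shows "A \<star>\<^bsub>N\<^esub> B \<in> carrier_tensor (Is @ Js)"
  using assms by (simp add: carrier_tensor_def einstein_product_def Let_def)

lemma entry_einstein_product:
  assumes "A \<in> carrier_tensor (Is @ Ks)" "B \<in> carrier_tensor (Ks @ Js)" "length Ks = N"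
    and "i \<in> multi_indices Is" "j \<in> multi_indices Js"
  shows "entry (A \<star>\<^bsub>N\<^esub> B) (i @ j) = (\<Sum>k\<in>multi_indices Ks. entry A (i @ k) * entry B (k @ j))"
  using assms append_in_multi_indices[of i Is j Js]
  by (simp add: carrier_tensor_def einstein_product_def Let_def entry_mk_tensor length_multi_indices)

lemma entry_conj_transpose:
  assumes "A \<in> carrier_tensor (Is @ Js)" "length Is = N" "length Js = N"
    and "i \<in> multi_indices Is" "j \<in> multi_indices Js"
  shows "entry (conj_transpose N A) (j @ i) = cnj (entry A (i @ j))"
  using assms append_in_multi_indices[of j Js i Is]
  by (simp add: carrier_tensor_def conj_transpose_def entry_mk_tensor length_multi_indices)

end

theory Submission
  imports Defs
begin

text \<open>
  The statement only speaks of products, adjoints and the Penrose equations, so it is proved in an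
  abstract ring with a proper involution (\<open>x\<^sup>* x = 0\<close> forces \<open>x = 0\<close>) and carried over.

  In such a ring write \<open>P = A\<^sup>\<dagger> A\<close> and \<open>Q = B B\<^sup>\<dagger>\<close>, which are self-adjoint idempotents. If
  \<open>B\<^sup>\<dagger> A\<^sup>\<dagger>\<close> is an inner inverse of \<open>A B\<close>, then \<open>P Q\<close> is idempotent, and properness of the involution
  turns this into \<open>P Q = Q P\<close>. The first equation of the criterion is then \<open>P B = Q P B\<close>, and the
  second one follows from the self-adjointness of \<open>A Q A\<^sup>\<dagger> = A B (A B)\<^sup>\<dagger>\<close>. Conversely, the first equation makes \<open>P Q\<close>
  self-adjoint, hence again \<open>P Q = Q P\<close>, so that \<open>B\<^sup>\<dagger> A\<^sup>\<dagger>\<close> is an outer inverse of \<open>A B\<close>; the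
  remaining Penrose conditions hold because the two equations identify \<open>B\<^sup>\<dagger> A\<^sup>\<dagger> A B\<close> and
  \<open>A B B\<^sup>\<dagger> A\<^sup>\<dagger>\<close> with the self-adjoint elements \<open>(A B)\<^sup>\<dagger> A B\<close> and \<open>A B (A B)\<^sup>\<dagger>\<close>. This is \<open>reverse_order_law\<close>.

  Tensors enter through \<open>tmat\<close>, which regards a tensor with \<open>N\<close> row modes as a matrix indexed by
  multi-indices. Finitely supported matrices over an infinite index set form one ring, whatever the
  shapes involved, so associativity and distributivity become unconditional; on tensors of one fixed
  shape the passage to matrices is injective and turns the Einstein product and the conjugate
  transpose into product and involution.

  Since the Moore-Penrose inverse is introduced by a definite description, its existence has to be
  established as well. It follows from the solvability of the normal equations
  \<open>A\<^sup>* A X = A\<^sup>*\<close> and \<open>A A\<^sup>* Y = A\<close>, because \<open>Y\<^sup>* A X\<close> is then the Moore-Penrose inverse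
  (\<open>penrose_from_normal_equations\<close>); the normal equations are solved by Gram-Schmidt
  orthogonalisation, adding one column at a time (\<open>least_squares\<close>).
\<close>

section \<open>Moore-Penrose inverses in rings with a proper involution\<close>

class proper_star_ring = ring +
  fixes adj :: "'a \<Rightarrow> 'a"
  assumes adj_adj [simp]: "adj (adj x) = x"
    and adj_add: "adj (x + y) = adj x + adj y"
    and adj_mult: "adj (x * y) = adj y * adj x"
    and adj_mult_self_zero: "adj x * x = 0 \<Longrightarrow> x = 0"
begin

lemma adj_diff: "adj (x - y) = adj x - adj y"
  using adj_add[of "x - y" y] by (simp add: algebra_simps)

definition penrose :: "'a \<Rightarrow> 'a \<Rightarrow> bool" where
  "penrose a x \<longleftrightarrow> a * x * a = a \<and> x * a * x = x \<and> adj (a * x) = a * x \<and> adj (x * a) = x * a"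

lemma penrose_unique:
  assumes "penrose a x" "penrose a y"
  shows "x = y"
proof -
  have ax: "a * x = a * y"
  proof -
    have "a * x = adj (a * y * a * x)"
      using assms by (simp add: penrose_def)
    also have "\<dots> = adj (a * x) * adj (a * y)"
      by (simp only: adj_mult mult.assoc)
    also have "\<dots> = a * x * a * y"
      using assms by (simp add: penrose_def mult.assoc [symmetric])
    also have "\<dots> = a * y"
      using assms by (simp add: penrose_def)
    finally show ?thesis .
  qed
  have xa: "x * a = y * a"
  proof -
    have "x * a = adj (x * (a * y * a))"
      using assms by (simp add: penrose_def)
    also have "\<dots> = adj (y * a) * adj (x * a)"
      by (simp only: adj_mult mult.assoc)
    also have "\<dots> = y * (a * x * a)"
      using assms by (simp add: penrose_def mult.assoc)
    also have "\<dots> = y * a"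
      using assms by (simp add: penrose_def)
    finally show ?thesis .
  qed
  have "x = x * a * x"
    using assms by (simp add: penrose_def)
  also have "\<dots> = y * (a * x)"
    by (simp add: xa mult.assoc)
  also have "\<dots> = y * a * y"
    by (simp add: ax mult.assoc)
  also have "\<dots> = y"
    using assms by (simp add: penrose_def)
  finally show ?thesis .
qed

text \<open>A solution \<open>x\<close> of the normal equations for \<open>a\<close> is an inner inverse with \<open>a x\<close> self-adjoint;
  by duality the adjoint of a solution \<open>y\<close> for \<open>a\<^sup>*\<close> is an inner inverse with \<open>y\<^sup>* a\<close> self-adjoint.
  Sandwiching \<open>a\<close> between them keeps both projections.\<close>

lemma penrose_from_normal_equations:
  assumes x: "adj a * a * x = adj a" and y: "a * adj a * y = a"
  shows "penrose a (adj y * a * x)"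
proof -
  have x': "adj x * adj a * a = a"
    using arg_cong[OF x, of adj] by (simp add: adj_mult mult.assoc)
  have y': "adj y * a * adj a = adj a"
    using arg_cong[OF y, of adj] by (simp add: adj_mult mult.assoc)
  have ax: "adj (a * x) = a * x"
  proof -
    have "adj (a * x) = adj x * (adj a * a * x)"
      by (simp add: x adj_mult)
    also have "\<dots> = a * x"
      using x' by (simp add: mult.assoc [symmetric])
    finally show ?thesis .
  qed
  have ya: "adj (adj y * a) = adj y * a"
  proof -
    have "adj (adj y * a) = adj y * a * adj a * y"
      by (simp add: y' adj_mult)
    also have "\<dots> = adj y * a"
      using y by (simp add: mult.assoc)
    finally show ?thesis .
  qed
  have axa: "a * x * a = a"
    using ax x' by (simp add: adj_mult)
  have aya: "a * (adj y * a) = a"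
  proof -
    have "a * (adj y * a) = a * adj (adj y * a)"
      by (simp only: ya)
    then show ?thesis
      using y by (simp add: adj_mult mult.assoc)
  qed
  have l: "a * (adj y * a * x) = a * x"
    using aya by (simp add: mult.assoc [symmetric])
  have r: "adj y * a * x * a = adj y * a"
    using axa by (simp add: mult.assoc)
  have "adj y * a * (adj y * a * x) = adj y * a * x"
    using l by (simp add: mult.assoc)
  then show ?thesis
    unfolding penrose_def l r using ax ya axa by simp
qed

text \<open>The off-diagonal part \<open>d = q p - p q p\<close> of \<open>q\<close> relative to \<open>p\<close> satisfies
  \<open>d\<^sup>* d = p q p - p q p q p = 0\<close>, so it vanishes and \<open>q p = p q p\<close> is self-adjoint.\<close>

lemma projections_commute:
  assumes p: "p * p = p" "adj p = p" and q: "q * q = q" "adj q = q"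
    and pq: "p * q * (p * q) = p * q"
  shows "p * q = q * p"
proof -
  let ?d = "q * p - p * q * p"
  have pp: "p * (p * z) = p * z" and qq: "q * (q * z) = q * z" for z
    using p(1) q(1) by (simp_all add: mult.assoc [symmetric])
  have pqpq: "p * (q * (p * (q * z))) = p * (q * z)" for z
    using arg_cong[OF pq, of "\<lambda>w. w * z"] by (simp add: mult.assoc)
  have "adj ?d * ?d = 0"
    using p q pq by (simp add: adj_diff adj_mult algebra_simps pp qq pqpq)
  then have d: "q * p = p * q * p"
    using adj_mult_self_zero[of ?d] by simp
  from arg_cong[OF d, of adj] have "p * q = p * q * p"
    unfolding adj_mult p(2) q(2) mult.assoc .
  also have "\<dots> = q * p"
    using d by (rule sym)
  finally show ?thesis .
qed

theorem reverse_order_law: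
  assumes a: "penrose a a'" and b: "penrose b b'" and x: "penrose (a * b) x"
  shows "x = b' * a' \<longleftrightarrow>
    a' * a * b = b * x * a * b \<and> b * b' * adj a = adj a * a * b * x"
proof -
  define p q where "p = a' * a" and "q = b * b'"
  have p: "p * p = p" "adj p = p" and q: "q * q = q" "adj q = q"
    using a b by (simp_all add: p_def q_def penrose_def mult.assoc [symmetric])
  have ap: "a * p = a" and pa': "p * a' = a'" and qb: "q * b = b" and b'q: "b' * q = b'"
    using a b by (simp_all add: p_def q_def penrose_def mult.assoc [symmetric])
  have pa: "p * adj a = adj a"
    using arg_cong[OF ap, of adj] p by (simp add: adj_mult)
  have a'a: "adj a * adj a' = p" and aa': "adj a' * adj a = a * a'"
    using a by (simp_all add: p_def penrose_def adj_mult [symmetric])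
  show ?thesis
  proof
    assume xeq: "x = b' * a'"
    have cxc: "a * (q * (p * b)) = a * b" and cx: "adj (a * q * a') = a * q * a'"
      using x unfolding xeq by (simp_all add: penrose_def p_def q_def mult.assoc)
    have "p * q * (p * q) = a' * (a * (q * (p * b))) * b'"
      by (simp add: p_def q_def mult.assoc)
    also have "\<dots> = p * q"
      by (simp add: cxc) (simp add: p_def q_def mult.assoc)
    finally have comm: "p * q = q * p"
      using projections_commute p q by blast
    have "a' * a * b = p * (q * b)"
      by (simp add: p_def qb)
    also have "\<dots> = q * p * b"
      by (simp add: comm mult.assoc [symmetric])
    finally have 1: "a' * a * b = b * x * a * b"
      by (simp add: xeq p_def q_def mult.assoc)
    have "adj a * a * b * x = adj a * (a * q * a')"
      by (simp add: xeq q_def mult.assoc)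
    also have "\<dots> = adj a * adj (a * q * a')"
      by (simp only: cx)
    also have "\<dots> = p * q * adj a"
      using q by (simp add: adj_mult a'a mult.assoc [symmetric])
    also have "\<dots> = q * adj a"
      by (simp add: comm mult.assoc pa)
    finally show "a' * a * b = b * x * a * b \<and> b * b' * adj a = adj a * a * b * x"
      using 1 by (simp add: q_def)
  next
    assume "a' * a * b = b * x * a * b \<and> b * b' * adj a = adj a * a * b * x"
    then have 1: "p * b = b * x * a * b" and 2: "q * adj a = adj a * a * b * x"
      by (simp_all add: p_def q_def)
    have qpb: "q * p * b = p * b"
      using qb by (simp add: 1 mult.assoc) (simp add: mult.assoc [symmetric])
    have "q * p * q = p * q"
      using arg_cong[OF qpb, of "\<lambda>z. z * b'"] by (simp add: q_def mult.assoc)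
    moreover from arg_cong[OF this, of adj] have "q * p * q = q * p"
      using p q by (simp add: adj_mult mult.assoc)
    ultimately have comm: "p * q = q * p"
      by simp
    \<comment> \<open>As \<open>x = b\<^sup>* z\<close> for some \<open>z\<close>, and \<open>b' b\<close> fixes \<open>b\<^sup>*\<close>, the projection \<open>b' b\<close> fixes \<open>x\<close>.\<close>
    have x_adj: "x = adj b * (adj a * adj x * x)"
    proof -
      have "x = adj (x * (a * b)) * x"
        using x by (simp add: penrose_def)
      then show ?thesis
        by (simp add: adj_mult mult.assoc)
    qed
    have "b' * b * adj b = adj (b * (b' * b))"
      using b by (simp add: penrose_def adj_mult)
    also have "\<dots> = adj b"
      using b by (simp add: penrose_def mult.assoc)
    finally have bb: "b' * b * adj b = adj b" .
    have b'bx: "b' * b * x = x"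
      by (subst x_adj, subst (2) x_adj) (simp add: bb mult.assoc [symmetric])
    have "b' * a' * (a * b) = b' * (p * b)"
      by (simp add: p_def mult.assoc)
    also have "\<dots> = b' * b * x * (a * b)"
      by (simp add: 1 mult.assoc)
    finally have yc: "b' * a' * (a * b) = x * (a * b)"
      by (simp add: b'bx)
    have "adj (a * q * a') = adj a' * (q * adj a)"
      using q by (simp add: adj_mult mult.assoc)
    also have "\<dots> = a * a' * a * b * x"
      by (simp add: 2 aa' mult.assoc [symmetric])
    also have "\<dots> = a * b * x"
      using a by (simp add: penrose_def)
    finally have "adj (adj (a * q * a')) = adj (a * b * x)"
      by simp
    then have cy: "a * b * (b' * a') = a * b * x"
      using x by (simp add: penrose_def q_def mult.assoc)
    have cyc: "a * b * (b' * a') * (a * b) = a * b"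
      using x by (simp only: cy) (simp add: penrose_def)
    have "b' * a' * (a * b) * (b' * a') = b' * (p * q) * a'"
      by (simp add: p_def q_def mult.assoc)
    also have "\<dots> = (b' * q) * (p * a')"
      by (simp add: comm mult.assoc)
    finally have ycy: "b' * a' * (a * b) * (b' * a') = b' * a'"
      by (simp add: pa' b'q)
    have "penrose (a * b) (b' * a')"
      using x cyc ycy unfolding penrose_def yc cy by simp
    then show "x = b' * a'"
      using x penrose_unique by blast
  qed
qed

end

section \<open>The ring of finitely supported matrices\<close>

lemma sum_cnj_mult_self_zero:
  fixes u :: "'i \<Rightarrow> complex"
  assumes "finite I" "(\<Sum>i\<in>I. cnj (u i) * u i) = 0" "i \<in> I"
  shows "u i = 0"
proof -
  have "complex_of_real (\<Sum>i\<in>I. (cmod (u i))\<^sup>2) = (\<Sum>i\<in>I. cnj (u i) * u i)"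
    unfolding of_real_sum
    by (rule sum.cong) (simp_all only: complex_norm_square mult.commute)
  then have "(\<Sum>i\<in>I. (cmod (u i))\<^sup>2) = 0"
    using assms(2) by (simp only: of_real_eq_0_iff)
  then have "\<forall>i\<in>I. (cmod (u i))\<^sup>2 = 0"
    using assms(1) by (subst (asm) sum_nonneg_eq_0_iff) simp_all
  then show ?thesis
    using assms(3) by simp
qed

text \<open>The index type may be infinite, so that rectangular matrices of all finite shapes live in one
  ring. It then has no unit.\<close>

typedef 'i fmat = "{f :: 'i \<Rightarrow> 'i \<Rightarrow> complex. finite {(i, j). f i j \<noteq> 0}}"
  by (rule exI[of _ "\<lambda>_ _. 0"]) simp

setup_lifting type_definition_fmat

lift_definition coeff :: "'i fmat \<Rightarrow> 'i \<Rightarrow> 'i \<Rightarrow> complex" is "\<lambda>f. f" .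

lemma fmat_eqI: "(\<And>i j. coeff a i j = coeff b i j) \<Longrightarrow> a = b"
  by transfer blast

lemma finite_support_square:
  fixes f :: "'i \<Rightarrow> 'i \<Rightarrow> complex"
  shows "finite {(i, j). f i j \<noteq> 0} \<longleftrightarrow> (\<exists>K. finite K \<and> (\<forall>i j. f i j \<noteq> 0 \<longrightarrow> i \<in> K \<and> j \<in> K))"
proof
  let ?S = "{(i, j). f i j \<noteq> 0}"
  assume "finite ?S"
  then show "\<exists>K. finite K \<and> (\<forall>i j. f i j \<noteq> 0 \<longrightarrow> i \<in> K \<and> j \<in> K)"
    by (intro exI[of _ "Domain ?S \<union> Range ?S"] conjI finite_UnI finite_Domain finite_Range) auto
next
  assume "\<exists>K. finite K \<and> (\<forall>i j. f i j \<noteq> 0 \<longrightarrow> i \<in> K \<and> j \<in> K)"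
  then obtain K where "finite K" "\<forall>i j. f i j \<noteq> 0 \<longrightarrow> i \<in> K \<and> j \<in> K"
    by blast
  then have "{(i, j). f i j \<noteq> 0} \<subseteq> K \<times> K" "finite (K \<times> K)"
    by auto
  then show "finite {(i, j). f i j \<noteq> 0}"
    by (rule finite_subset)
qed

instantiation fmat :: (type) times
begin

lift_definition times_fmat :: "'a fmat \<Rightarrow> 'a fmat \<Rightarrow> 'a fmat" is
  "\<lambda>f g i j. \<Sum>k | f i k \<noteq> 0. f i k * g k j"
  subgoal for f g
  proof -
    assume "finite {(i, j). f i j \<noteq> 0}" and "finite {(i, j). g i j \<noteq> 0}"
    then obtain K L where K: "finite K" "\<forall>i j. f i j \<noteq> 0 \<longrightarrow> i \<in> K \<and> j \<in> K"
      and L: "finite L" "\<forall>i j. g i j \<noteq> 0 \<longrightarrow> i \<in> L \<and> j \<in> L"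
      unfolding finite_support_square by blast
    have "i \<in> K \<union> L \<and> j \<in> K \<union> L" if "(\<Sum>k | f i k \<noteq> 0. f i k * g k j) \<noteq> 0" for i j
    proof -
      from that obtain k where "f i k * g k j \<noteq> 0"
        by (meson sum.not_neutral_contains_not_neutral)
      then show ?thesis
        using K(2) L(2) by fastforce
    qed
    then show ?thesis
      unfolding finite_support_square using K(1) L(1) by (intro exI[of _ "K \<union> L"]) simp
  qed
  done

instance ..

end

text \<open>The entrywise product formula may be summed over any finite set containing the relevant
  indices, so that several products can be compared over one common set.\<close>

lemma coeff_times:
  assumes "finite K" "\<And>k. coeff a i k \<noteq> 0 \<Longrightarrow> coeff b k j \<noteq> 0 \<Longrightarrow> k \<in> K"
  shows "coeff (a * b) i j = (\<Sum>k\<in>K. coeff a i k * coeff b k j)"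
  using assms
proof (transfer fixing: i j K)
  fix f g :: "'a \<Rightarrow> 'a \<Rightarrow> complex"
  assume "finite {(i, j). f i j \<noteq> 0}" and K: "finite K" "\<And>k. f i k \<noteq> 0 \<Longrightarrow> g k j \<noteq> 0 \<Longrightarrow> k \<in> K"
  then obtain L where L: "finite L" "\<forall>i j. f i j \<noteq> 0 \<longrightarrow> i \<in> L \<and> j \<in> L"
    unfolding finite_support_square by blast
  have "(\<Sum>k | f i k \<noteq> 0. f i k * g k j) = (\<Sum>k\<in>L \<union> K. f i k * g k j)"
    by (rule sum.mono_neutral_left) (use K L in auto)
  also have "\<dots> = (\<Sum>k\<in>K. f i k * g k j)"
    by (rule sum.mono_neutral_right) (use K L in auto)
  finally show "(\<Sum>k | f i k \<noteq> 0. f i k * g k j) = (\<Sum>k\<in>K. f i k * g k j)" .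
qed

lemma fmat_supported:
  obtains K where "finite K" "\<And>i j. coeff a i j \<noteq> 0 \<Longrightarrow> i \<in> K \<and> j \<in> K"
proof -
  have "finite {(i, j). coeff a i j \<noteq> 0}"
    using Rep_fmat[of a] by (simp add: coeff.rep_eq)
  then show ?thesis
    unfolding finite_support_square using that by blast
qed

instantiation fmat :: (type) proper_star_ring
begin

lift_definition zero_fmat :: "'a fmat" is "\<lambda>_ _. 0" by simp

lift_definition plus_fmat :: "'a fmat \<Rightarrow> 'a fmat \<Rightarrow> 'a fmat" is "\<lambda>f g i j. f i j + g i j"
  subgoal for f g
    by (rule finite_subset[of _ "{(i, j). f i j \<noteq> 0} \<union> {(i, j). g i j \<noteq> 0}"]) auto
  done

lift_definition uminus_fmat :: "'a fmat \<Rightarrow> 'a fmat" is "\<lambda>f i j. - f i j" by simp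

lift_definition minus_fmat :: "'a fmat \<Rightarrow> 'a fmat \<Rightarrow> 'a fmat" is "\<lambda>f g i j. f i j - g i j"
  subgoal for f g
    by (rule finite_subset[of _ "{(i, j). f i j \<noteq> 0} \<union> {(i, j). g i j \<noteq> 0}"]) auto
  done

lift_definition adj_fmat :: "'a fmat \<Rightarrow> 'a fmat" is "\<lambda>f i j. cnj (f j i)"
  unfolding finite_support_square by auto

lemma coeff_simps:
  "coeff 0 i j = 0" "coeff (a + b) i j = coeff a i j + coeff b i j"
  "coeff (- a) i j = - coeff a i j" "coeff (a - b) i j = coeff a i j - coeff b i j"
  "coeff (adj a) i j = cnj (coeff a j i)"
  by (transfer, simp)+

instance
proof
  fix a b c :: "'a fmat"
  show "a + b + c = a + (b + c)" "a + b = b + a" "0 + a = a" "- a + a = 0" "a - b = a + - b"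
    "adj (adj a) = a" "adj (a + b) = adj a + adj b"
    by (rule fmat_eqI, simp add: coeff_simps)+
  obtain K where K: "finite K" "\<And>i j. coeff a i j \<noteq> 0 \<Longrightarrow> i \<in> K \<and> j \<in> K"
    using fmat_supported[of a] by metis
  obtain L where L: "finite L" "\<And>i j. coeff b i j \<noteq> 0 \<Longrightarrow> i \<in> L \<and> j \<in> L"
    using fmat_supported[of b] by metis
  obtain M where M: "finite M" "\<And>i j. coeff c i j \<noteq> 0 \<Longrightarrow> i \<in> M \<and> j \<in> M"
    using fmat_supported[of c] by metis
  define S where "S = K \<union> L \<union> M"
  have S: "finite S" "\<And>i j. coeff a i j \<noteq> 0 \<Longrightarrow> i \<in> S \<and> j \<in> S"
      "\<And>i j. coeff b i j \<noteq> 0 \<Longrightarrow> i \<in> S \<and> j \<in> S" "\<And>i j. coeff c i j \<noteq> 0 \<Longrightarrow> i \<in> S \<and> j \<in> S"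
    using K(1) L(1) M(1) by (simp_all add: S_def) (metis K(2), metis L(2), metis M(2))
  have ab: "coeff (a * b) i j = (\<Sum>k\<in>S. coeff a i k * coeff b k j)" for i j
    by (rule coeff_times) (use S in blast)+
  have bc: "coeff (b * c) i j = (\<Sum>k\<in>S. coeff b i k * coeff c k j)" for i j
    by (rule coeff_times) (use S in blast)+
  show "a * b * c = a * (b * c)"
  proof (rule fmat_eqI)
    fix i j
    have "coeff (a * b * c) i j = (\<Sum>k\<in>S. coeff (a * b) i k * coeff c k j)"
      by (rule coeff_times) (use S in blast)+
    also have "\<dots> = (\<Sum>l\<in>S. coeff a i l * coeff (b * c) l j)"
      unfolding ab bc sum_distrib_left sum_distrib_right
      by (subst sum.swap) (simp add: mult.assoc)
    also have "\<dots> = coeff (a * (b * c)) i j"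
      by (rule coeff_times[symmetric]) (use S in blast)+
    finally show "coeff (a * b * c) i j = coeff (a * (b * c)) i j" .
  qed
  show "(a + b) * c = a * c + b * c"
  proof (rule fmat_eqI)
    fix i j
    have "coeff ((a + b) * c) i j = (\<Sum>k\<in>S. coeff (a + b) i k * coeff c k j)"
      "coeff (a * c) i j = (\<Sum>k\<in>S. coeff a i k * coeff c k j)"
      by (rule coeff_times; use S in blast)+
    then show "coeff ((a + b) * c) i j = coeff (a * c + b * c) i j"
      by (simp add: bc coeff_simps distrib_right sum.distrib)
  qed
  show "a * (b + c) = a * b + a * c"
  proof (rule fmat_eqI)
    fix i j
    have "coeff (a * (b + c)) i j = (\<Sum>k\<in>S. coeff a i k * coeff (b + c) k j)"
      "coeff (a * c) i j = (\<Sum>k\<in>S. coeff a i k * coeff c k j)"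
      by (rule coeff_times; use S in blast)+
    then show "coeff (a * (b + c)) i j = coeff (a * b + a * c) i j"
      by (simp add: ab coeff_simps distrib_left sum.distrib)
  qed
  show "adj (a * b) = adj b * adj a"
  proof (rule fmat_eqI)
    fix i j
    have "coeff (adj b * adj a) i j = (\<Sum>k\<in>S. coeff (adj b) i k * coeff (adj a) k j)"
      by (rule coeff_times) (use S in \<open>simp_all add: coeff_simps\<close>)
    then show "coeff (adj (a * b)) i j = coeff (adj b * adj a) i j"
      by (simp add: ab coeff_simps mult.commute)
  qed
  show "a = 0" if "adj a * a = 0"
  proof (rule fmat_eqI)
    fix i j
    have "(\<Sum>k\<in>S. coeff (adj a) j k * coeff a k j) = coeff (adj a * a) j j"
      by (rule coeff_times[symmetric]) (use S in blast)+
    then have "(\<Sum>k\<in>S. cnj (coeff a k j) * coeff a k j) = 0"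
      using that by (simp only: coeff_simps)
    from sum_cnj_mult_self_zero[OF S(1) this] have "\<forall>k\<in>S. coeff a k j = 0"
      by blast
    then show "coeff a i j = coeff 0 i j"
      using S(2) by (auto simp: coeff_simps)
  qed
qed

end

section \<open>Least squares\<close>

text \<open>The residual \<open>r = b - a x\<close> can be made orthogonal to all columns of \<open>a\<close>. For a further column
  \<open>v\<close>, let \<open>w\<close> be its own residual with respect to the old columns; subtracting from \<open>r\<close> the multiple
  of \<open>w\<close> that achieves orthogonality to \<open>v\<close> does not disturb orthogonality to the old columns. If
  \<open>\<langle>v, w\<rangle> = \<langle>w, w\<rangle>\<close> vanishes, then \<open>w = 0\<close>, and \<open>r\<close> is already orthogonal to \<open>v\<close>.\<close>

lemma least_squares:
  fixes a :: "'i \<Rightarrow> 'k \<Rightarrow> complex"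
  assumes "finite K" and I: "finite I"
  shows "\<exists>x. \<forall>k\<in>K. (\<Sum>i\<in>I. cnj (a i k) * (b i - (\<Sum>l\<in>K. a i l * x l))) = 0"
  using assms(1)
proof (induction K arbitrary: b)
  case empty
  show ?case by simp
next
  case (insert v K)
  from insert.IH[of b] obtain x where x: "\<forall>k\<in>K. (\<Sum>i\<in>I. cnj (a i k) * (b i - (\<Sum>l\<in>K. a i l * x l))) = 0"
    by blast
  from insert.IH[of "\<lambda>i. a i v"] obtain y where
    y: "\<forall>k\<in>K. (\<Sum>i\<in>I. cnj (a i k) * (a i v - (\<Sum>l\<in>K. a i l * y l))) = 0"
    by blast
  define r where "r i = b i - (\<Sum>l\<in>K. a i l * x l)" for i
  define w where "w i = a i v - (\<Sum>l\<in>K. a i l * y l)" for i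
  define vw where "vw = (\<Sum>i\<in>I. cnj (a i v) * w i)"
  define vr where "vr = (\<Sum>i\<in>I. cnj (a i v) * r i)"
  define c where "c = vr / vw"
  have r: "(\<Sum>i\<in>I. cnj (a i k) * r i) = 0" and w: "(\<Sum>i\<in>I. cnj (a i k) * w i) = 0" if "k \<in> K" for k
    using x y that by (simp_all add: r_def w_def)
  \<comment> \<open>\<open>v - w\<close> is a combination of the old columns, so \<open>v\<close> and \<open>w\<close> have the same inner product
    with any \<open>u\<close> orthogonal to these.\<close>
  have on_v: "(\<Sum>i\<in>I. cnj (a i v) * u i) = (\<Sum>i\<in>I. cnj (w i) * u i)"
    if u: "\<And>k. k \<in> K \<Longrightarrow> (\<Sum>i\<in>I. cnj (a i k) * u i) = 0" for u
  proof -
    have "(\<Sum>i\<in>I. cnj (a i v) * u i) - (\<Sum>i\<in>I. cnj (w i) * u i)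
        = (\<Sum>i\<in>I. \<Sum>l\<in>K. cnj (y l) * (cnj (a i l) * u i))"
      unfolding sum_subtractf [symmetric] w_def
      by (simp add: algebra_simps sum_distrib_left)
    also have "\<dots> = (\<Sum>l\<in>K. cnj (y l) * (\<Sum>i\<in>I. cnj (a i l) * u i))"
      by (subst sum.swap) (simp add: sum_distrib_left)
    also have "\<dots> = 0"
      using u by simp
    finally show ?thesis by simp
  qed
  have vr: "vr - c * vw = 0"
  proof (cases "vw = 0")
    case True
    have "(\<Sum>i\<in>I. cnj (w i) * w i) = 0"
      using True on_v[OF w] by (simp add: vw_def)
    from sum_cnj_mult_self_zero[OF I this] have "\<forall>i\<in>I. w i = 0"
      by blast
    then have "vr = 0"
      using on_v[OF r] by (simp add: vr_def)
    then show ?thesis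
      using True by simp
  qed (simp add: c_def)
  let ?z = "\<lambda>l. if l = v then c else x l - c * y l"
  have res: "b i - (\<Sum>l\<in>insert v K. a i l * ?z l) = r i - c * w i" for i
  proof -
    have "(\<Sum>l\<in>K. a i l * ?z l) = (\<Sum>l\<in>K. a i l * x l - c * (a i l * y l))"
      by (rule sum.cong) (use insert.hyps in \<open>auto simp: algebra_simps\<close>)
    then show ?thesis
      using insert.hyps by (simp add: r_def w_def sum_subtractf sum_distrib_left algebra_simps)
  qed
  have split: "(\<Sum>i\<in>I. cnj (a i k) * (r i - c * w i)) =
      (\<Sum>i\<in>I. cnj (a i k) * r i) - c * (\<Sum>i\<in>I. cnj (a i k) * w i)" for k
    by (simp add: sum_subtractf sum_distrib_left algebra_simps)
  have "(\<Sum>i\<in>I. cnj (a i k) * (r i - c * w i)) = 0" if "k \<in> insert v K" for k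
    using that vr r w unfolding split by (auto simp: vr_def vw_def)
  then show ?case
    by (intro exI[of _ ?z]) (simp only: res, blast)
qed

section \<open>Tensors as matrices\<close>

lemma finite_multi_indices [simp]: "finite (multi_indices ds)"
proof (induction ds)
  case Nil
  show ?case by (simp add: multi_indices_def)
next
  case (Cons d ds)
  have "multi_indices (d # ds) \<subseteq> (\<lambda>(i, ix). i # ix) ` ({..<d} \<times> multi_indices ds)"
    by (auto simp: multi_indices_def list_all2_Cons2)
  then show ?case
    by (rule finite_subset) (simp add: Cons.IH)
qed

lemma append_in_multi_indices_iff:
  assumes "length i = length Is"
  shows "i @ j \<in> multi_indices (Is @ Js) \<longleftrightarrow> i \<in> multi_indices Is \<and> j \<in> multi_indices Js"
  using assms by (simp add: multi_indices_def list_all2_append)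

lemma entry_outside: "ix \<notin> multi_indices (dims A) \<Longrightarrow> entry A ix = 0"
  by transfer auto

text \<open>Row indices are cut off at length \<open>N\<close> because a multi-index can be split in several ways.\<close>

definition tmat :: "nat \<Rightarrow> tensor \<Rightarrow> nat list fmat" where
  "tmat N A = Abs_fmat (\<lambda>i j. if length i = N then entry A (i @ j) else 0)"

lemma coeff_tmat: "coeff (tmat N A) i j = (if length i = N then entry A (i @ j) else 0)"
proof -
  let ?f = "\<lambda>i j. if length i = N then entry A (i @ j) else 0"
  let ?split = "\<lambda>ix. (take N ix, drop N ix)"
  have "(i, j) \<in> ?split ` multi_indices (dims A)" if "?f i j \<noteq> 0" for i j
  proof -
    have "i @ j \<in> multi_indices (dims A)" and "(i, j) = ?split (i @ j)"
      using that by (auto split: if_splits intro: ccontr simp: entry_outside)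
    then show ?thesis
      by blast
  qed
  then have "{(i, j). ?f i j \<noteq> 0} \<subseteq> ?split ` multi_indices (dims A)"
    by blast
  then have "finite {(i, j). ?f i j \<noteq> 0}"
    by (rule finite_subset) simp
  then show ?thesis
    by (simp add: tmat_def coeff.rep_eq Abs_fmat_inverse)
qed

lemma coeff_tmat_outside:
  assumes "A \<in> carrier_tensor (Is @ Js)" "length Is = N"
    and "i \<notin> multi_indices Is \<or> j \<notin> multi_indices Js"
  shows "coeff (tmat N A) i j = 0"
  using assms append_in_multi_indices_iff[of i Is j Js]
  by (auto simp: coeff_tmat carrier_tensor_def intro!: entry_outside)

lemma fmat_eq_on_blockI:
  assumes "\<And>i j. i \<notin> multi_indices Is \<or> j \<notin> multi_indices Js \<Longrightarrow> coeff a i j = 0"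
    and "\<And>i j. i \<notin> multi_indices Is \<or> j \<notin> multi_indices Js \<Longrightarrow> coeff b i j = 0"
    and "\<And>i j. i \<in> multi_indices Is \<Longrightarrow> j \<in> multi_indices Js \<Longrightarrow> coeff a i j = coeff b i j"
  shows "a = b"
  using assms by (metis fmat_eqI)

lemma tmat_eq_iff:
  assumes "A \<in> carrier_tensor (Is @ Js)" "B \<in> carrier_tensor (Is @ Js)" "length Is = N"
  shows "tmat N A = tmat N B \<longleftrightarrow> A = B"
proof
  assume eq: "tmat N A = tmat N B"
  show "A = B"
  proof (rule tensor_eqI)
    show "dims A = dims B"
      using assms by (simp add: carrier_tensor_def)
    fix ix assume "ix \<in> multi_indices (dims A)"
    then have "length (take N ix) = N"
      using assms by (auto simp: carrier_tensor_def dest: length_multi_indices)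
    then show "entry A ix = entry B ix"
      using arg_cong[OF eq, of "\<lambda>M. coeff M (take N ix) (drop N ix)"] by (simp add: coeff_tmat)
  qed
qed simp

lemma tmat_einstein_product:
  assumes A: "A \<in> carrier_tensor (Is @ Ks)" and B: "B \<in> carrier_tensor (Ks @ Js)"
    and "length Is = N" "length Ks = N"
  shows "tmat N (A \<star>\<^bsub>N\<^esub> B) = tmat N A * tmat N B"
proof -
  have prod: "coeff (tmat N A * tmat N B) i j =
      (\<Sum>k\<in>multi_indices Ks. coeff (tmat N A) i k * coeff (tmat N B) k j)" for i j
    by (rule coeff_times) (use coeff_tmat_outside[OF A] assms in \<open>auto\<close>)
  show ?thesis
  proof (rule fmat_eq_on_blockI[of Is Js])
    fix i j
    assume out: "i \<notin> multi_indices Is \<or> j \<notin> multi_indices Js"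
    show "coeff (tmat N (A \<star>\<^bsub>N\<^esub> B)) i j = 0"
      using coeff_tmat_outside[OF einstein_product_carrier[OF A B]] out assms by blast
    show "coeff (tmat N A * tmat N B) i j = 0"
      unfolding prod using coeff_tmat_outside[OF A] coeff_tmat_outside[OF B] out assms
      by (intro sum.neutral) auto
  next
    fix i j
    assume ij: "i \<in> multi_indices Is" "j \<in> multi_indices Js"
    have "coeff (tmat N (A \<star>\<^bsub>N\<^esub> B)) i j = entry (A \<star>\<^bsub>N\<^esub> B) (i @ j)"
      using assms ij by (simp add: coeff_tmat length_multi_indices)
    also have "\<dots> = (\<Sum>k\<in>multi_indices Ks. entry A (i @ k) * entry B (k @ j))"
      using entry_einstein_product[OF A B] assms ij by blast
    finally show "coeff (tmat N (A \<star>\<^bsub>N\<^esub> B)) i j = coeff (tmat N A * tmat N B) i j"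
      unfolding prod using assms ij by (simp add: coeff_tmat length_multi_indices)
  qed
qed

lemma conj_transpose_carrier:
  assumes "A \<in> carrier_tensor (Is @ Js)" "length Is = N"
  shows "conj_transpose N A \<in> carrier_tensor (Js @ Is)"
  using assms by (simp add: carrier_tensor_def conj_transpose_def)

lemma tmat_conj_transpose:
  assumes A: "A \<in> carrier_tensor (Is @ Js)" and "length Is = N" "length Js = N"
  shows "tmat N (conj_transpose N A) = adj (tmat N A)"
proof (rule fmat_eq_on_blockI[of Js Is])
  fix j i
  assume out: "j \<notin> multi_indices Js \<or> i \<notin> multi_indices Is"
  show "coeff (tmat N (conj_transpose N A)) j i = 0"
    using coeff_tmat_outside[OF conj_transpose_carrier[OF A]] out assms by blast
  show "coeff (adj (tmat N A)) j i = 0"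
    using coeff_tmat_outside[OF A] out assms by (auto simp: coeff_simps)
next
  fix j i
  assume "j \<in> multi_indices Js" "i \<in> multi_indices Is"
  then show "coeff (tmat N (conj_transpose N A)) j i = coeff (adj (tmat N A)) j i"
    using entry_conj_transpose[OF A, of N i j] assms
    by (simp add: coeff_tmat coeff_simps length_multi_indices)
qed

section \<open>The Moore-Penrose inverse of a tensor\<close>

lemma is_MP_inverse_iff_penrose:
  assumes A: "A \<in> carrier_tensor (Is @ Js)" and N: "length Is = N" "length Js = N"
  shows "is_MP_inverse N A X \<longleftrightarrow> X \<in> carrier_tensor (Js @ Is) \<and> penrose (tmat N A) (tmat N X)"
proof (cases "X \<in> carrier_tensor (Js @ Is)")
  case X: True
  note AX = einstein_product_carrier[OF A X N(2)] and XA = einstein_product_carrier[OF X A N(1)]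
  note mults = tmat_einstein_product[OF A X N] tmat_einstein_product[OF X A N(2,1)]
    tmat_einstein_product[OF AX A N(1,1)] tmat_einstein_product[OF XA X N(2,2)]
    tmat_conj_transpose[OF AX N(1,1)] tmat_conj_transpose[OF XA N(2,2)]
  have "A \<star>\<^bsub>N\<^esub> X \<star>\<^bsub>N\<^esub> A = A \<longleftrightarrow> tmat N A * tmat N X * tmat N A = tmat N A"
    using tmat_eq_iff[OF einstein_product_carrier[OF AX A N(1)] A N(1)] by (simp add: mults)
  moreover have "X \<star>\<^bsub>N\<^esub> A \<star>\<^bsub>N\<^esub> X = X \<longleftrightarrow> tmat N X * tmat N A * tmat N X = tmat N X"
    using tmat_eq_iff[OF einstein_product_carrier[OF XA X N(2)] X N(2)] by (simp add: mults)
  moreover have "conj_transpose N (A \<star>\<^bsub>N\<^esub> X) = A \<star>\<^bsub>N\<^esub> X \<longleftrightarrow>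
      adj (tmat N A * tmat N X) = tmat N A * tmat N X"
    using tmat_eq_iff[OF conj_transpose_carrier[OF AX N(1)] AX N(1)] by (simp add: mults)
  moreover have "conj_transpose N (X \<star>\<^bsub>N\<^esub> A) = X \<star>\<^bsub>N\<^esub> A \<longleftrightarrow>
      adj (tmat N X * tmat N A) = tmat N X * tmat N A"
    using tmat_eq_iff[OF conj_transpose_carrier[OF XA N(2)] XA N(2)] by (simp add: mults)
  ultimately show ?thesis
    using A X N by (simp add: is_MP_inverse_def penrose_def carrier_tensor_def)
next
  case False
  then show ?thesis
    using A N by (simp add: is_MP_inverse_def carrier_tensor_def)
qed

text \<open>Column \<open>j\<close> of the solution is the least squares solution whose right-hand side is the unit vector
  at \<open>j\<close>.\<close>

lemma normal_equations_solvable: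
  assumes A: "A \<in> carrier_tensor (Is @ Js)" and N: "length Is = N" "length Js = N"
  shows "\<exists>X\<in>carrier_tensor (Js @ Is). adj (tmat N A) * tmat N A * tmat N X = adj (tmat N A)"
proof -
  let ?I = "multi_indices Is" and ?J = "multi_indices Js" and ?a = "coeff (tmat N A)"
  have "\<forall>j. \<exists>x. \<forall>k\<in>?J. (\<Sum>i\<in>?I. cnj (?a i k) * (of_bool (i = j) - (\<Sum>l\<in>?J. ?a i l * x l))) = 0"
    by (intro allI least_squares) simp_all
  from choice[OF this] obtain x where x: "\<And>j k. k \<in> ?J \<Longrightarrow>
      (\<Sum>i\<in>?I. cnj (?a i k) * (of_bool (i = j) - (\<Sum>l\<in>?J. ?a i l * x j l))) = 0"
    by blast
  define X where "X = mk_tensor (Js @ Is) (\<lambda>ix. x (drop N ix) (take N ix))"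
  have X: "X \<in> carrier_tensor (Js @ Is)"
    by (simp add: X_def carrier_tensor_def)
  have coeff_X: "coeff (tmat N X) l j = x j l" if "l \<in> ?J" "j \<in> ?I" for l j
    using that append_in_multi_indices[of l Js j Is] N
    by (simp add: coeff_tmat X_def entry_mk_tensor length_multi_indices)
  note aout = coeff_tmat_outside[OF A N(1)] and xout = coeff_tmat_outside[OF X N(2)]
  have ax: "coeff (tmat N A * tmat N X) i j = (\<Sum>l\<in>?J. ?a i l * coeff (tmat N X) l j)" for i j
    by (rule coeff_times) (use aout in auto)
  have aax: "coeff (adj (tmat N A) * (tmat N A * tmat N X)) k j =
      (\<Sum>i\<in>?I. cnj (?a i k) * coeff (tmat N A * tmat N X) i j)" for k j
    by (subst coeff_times[of ?I]) (use aout in \<open>auto simp: coeff_simps\<close>)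
  have "adj (tmat N A) * (tmat N A * tmat N X) = adj (tmat N A)"
  proof (rule fmat_eq_on_blockI[of Js Is])
    fix k j
    assume out: "k \<notin> ?J \<or> j \<notin> ?I"
    show "coeff (adj (tmat N A)) k j = 0"
      using aout out by (auto simp: coeff_simps)
    show "coeff (adj (tmat N A) * (tmat N A * tmat N X)) k j = 0"
      unfolding aax ax using aout xout out by (auto intro!: sum.neutral)
  next
    fix k j
    assume kj: "k \<in> ?J" "j \<in> ?I"
    have "(\<Sum>i\<in>?I. cnj (?a i k) * (of_bool (i = j) - (\<Sum>l\<in>?J. ?a i l * x j l))) =
        (\<Sum>i\<in>?I. cnj (?a i k) * of_bool (i = j)) - (\<Sum>i\<in>?I. cnj (?a i k) * (\<Sum>l\<in>?J. ?a i l * x j l))"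
      by (simp add: right_diff_distrib sum_subtractf)
    also have "(\<Sum>i\<in>?I. cnj (?a i k) * of_bool (i = j)) = cnj (?a j k)"
      using kj by (simp add: of_bool_def if_distrib[of "(*) _"] cong: if_cong)
    finally have "(\<Sum>i\<in>?I. cnj (?a i k) * (\<Sum>l\<in>?J. ?a i l * x j l)) = cnj (?a j k)"
      using x[of k j] kj by simp
    then show "coeff (adj (tmat N A) * (tmat N A * tmat N X)) k j = coeff (adj (tmat N A)) k j"
      using kj by (simp add: aax ax coeff_X coeff_simps)
  qed
  then show ?thesis
    using X by (auto simp: mult.assoc)
qed

lemma MP_inverse_exists:
  assumes A: "A \<in> carrier_tensor (Is @ Js)" and N: "length Is = N" "length Js = N"
  shows "\<exists>X. is_MP_inverse N A X"
proof -
  obtain X where X: "X \<in> carrier_tensor (Js @ Is)"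
    and nX: "adj (tmat N A) * tmat N A * tmat N X = adj (tmat N A)"
    using normal_equations_solvable[OF A N] by blast
  note A' = conj_transpose_carrier[OF A N(1)]
  obtain Y where Y: "Y \<in> carrier_tensor (Is @ Js)"
    and nY: "tmat N A * adj (tmat N A) * tmat N Y = tmat N A"
    using normal_equations_solvable[OF A' N(2,1)] by (auto simp: tmat_conj_transpose[OF A N])
  note Y' = conj_transpose_carrier[OF Y N(1)]
  note YA = einstein_product_carrier[OF Y' A N(1)]
  have "conj_transpose N Y \<star>\<^bsub>N\<^esub> A \<star>\<^bsub>N\<^esub> X \<in> carrier_tensor (Js @ Is)"
    using einstein_product_carrier[OF YA X N(2)] .
  moreover have "tmat N (conj_transpose N Y \<star>\<^bsub>N\<^esub> A \<star>\<^bsub>N\<^esub> X) = adj (tmat N Y) * tmat N A * tmat N X"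
    by (simp add: tmat_einstein_product[OF YA X N(2,2)] tmat_einstein_product[OF Y' A N(2,1)]
        tmat_conj_transpose[OF Y N])
  ultimately show ?thesis
    using penrose_from_normal_equations[OF nX nY] is_MP_inverse_iff_penrose[OF A N] by metis
qed

lemma MP_inverse_penrose:
  assumes A: "A \<in> carrier_tensor (Is @ Js)" and N: "length Is = N" "length Js = N"
  shows "MP_inverse N A \<in> carrier_tensor (Js @ Is)"
    and "penrose (tmat N A) (tmat N (MP_inverse N A))"
proof -
  have "\<exists>!X. is_MP_inverse N A X"
  proof (rule ex_ex1I[OF MP_inverse_exists[OF A N]])
    fix X Y assume "is_MP_inverse N A X" "is_MP_inverse N A Y"
    then show "X = Y"
      using is_MP_inverse_iff_penrose[OF A N] penrose_unique tmat_eq_iff[OF _ _ N(2)] by metis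
  qed
  then have "is_MP_inverse N A (MP_inverse N A)"
    unfolding MP_inverse_def by (rule theI')
  then show "MP_inverse N A \<in> carrier_tensor (Js @ Is)"
    and "penrose (tmat N A) (tmat N (MP_inverse N A))"
    using is_MP_inverse_iff_penrose[OF A N] by simp_all
qed

theorem theorem3p29:
  fixes N :: nat and Is Js :: "nat list" and A B :: tensor
  assumes "length Is = N" and "length Js = N"
    and "A \<in> carrier_tensor (Is @ Js)" and "B \<in> carrier_tensor (Js @ Is)"
  shows "MP_inverse N (A \<star>\<^bsub>N\<^esub> B) = MP_inverse N B \<star>\<^bsub>N\<^esub> MP_inverse N A \<longleftrightarrow>
    MP_inverse N A \<star>\<^bsub>N\<^esub> A \<star>\<^bsub>N\<^esub> B = B \<star>\<^bsub>N\<^esub> MP_inverse N (A \<star>\<^bsub>N\<^esub> B) \<star>\<^bsub>N\<^esub> A \<star>\<^bsub>N\<^esub> B \<and>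
    B \<star>\<^bsub>N\<^esub> MP_inverse N B \<star>\<^bsub>N\<^esub> conj_transpose N A =
      conj_transpose N A \<star>\<^bsub>N\<^esub> A \<star>\<^bsub>N\<^esub> B \<star>\<^bsub>N\<^esub> MP_inverse N (A \<star>\<^bsub>N\<^esub> B)"
proof -
  note N = assms(1,2) and A = assms(3) and B = assms(4)
  note AB = einstein_product_carrier[OF A B N(2)]
  define A' B' X T where "A' = MP_inverse N A" and "B' = MP_inverse N B"
    and "X = MP_inverse N (A \<star>\<^bsub>N\<^esub> B)" and "T = conj_transpose N A"
  have A': "A' \<in> carrier_tensor (Js @ Is)" "penrose (tmat N A) (tmat N A')"
    using MP_inverse_penrose[OF A N] by (simp_all add: A'_def)
  have B': "B' \<in> carrier_tensor (Is @ Js)" "penrose (tmat N B) (tmat N B')"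
    using MP_inverse_penrose[OF B N(2,1)] by (simp_all add: B'_def)
  have X: "X \<in> carrier_tensor (Is @ Is)" "penrose (tmat N A * tmat N B) (tmat N X)"
    using MP_inverse_penrose[OF AB N(1,1)] tmat_einstein_product[OF A B N] by (simp_all add: X_def)
  have T: "T \<in> carrier_tensor (Js @ Is)" "tmat N T = adj (tmat N A)"
    using conj_transpose_carrier[OF A N(1)] tmat_conj_transpose[OF A N] by (simp_all add: T_def)
  note BA' = einstein_product_carrier[OF B'(1) A'(1) N(2)]
    and A'A = einstein_product_carrier[OF A'(1) A N(1)]
    and BX = einstein_product_carrier[OF B X(1) N(1)]
    and BB' = einstein_product_carrier[OF B B'(1) N(1)]
    and TA = einstein_product_carrier[OF T(1) A N(1)]
  note A'AB = einstein_product_carrier[OF A'A B N(2)]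
    and BXA = einstein_product_carrier[OF BX A N(1)]
    and BB'T = einstein_product_carrier[OF BB' T(1) N(2)]
    and TAB = einstein_product_carrier[OF TA B N(2)]
  note BXAB = einstein_product_carrier[OF BXA B N(2)]
    and TABX = einstein_product_carrier[OF TAB X(1) N(1)]
  note mults = tmat_einstein_product[OF B'(1) A'(1) N] tmat_einstein_product[OF A'(1) A N(2,1)]
    tmat_einstein_product[OF B X(1) N(2,1)] tmat_einstein_product[OF B B'(1) N(2,1)]
    tmat_einstein_product[OF T(1) A N(2,1)] tmat_einstein_product[OF A'A B N(2,2)]
    tmat_einstein_product[OF BX A N(2,1)] tmat_einstein_product[OF BB' T(1) N(2,2)]
    tmat_einstein_product[OF TA B N(2,2)] tmat_einstein_product[OF BXA B N(2,2)]
    tmat_einstein_product[OF TAB X(1) N(2,1)] T(2)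
  have "X = B' \<star>\<^bsub>N\<^esub> A' \<longleftrightarrow> tmat N X = tmat N B' * tmat N A'"
    using tmat_eq_iff[OF X(1) BA' N(1)] by (simp add: mults)
  moreover have "A' \<star>\<^bsub>N\<^esub> A \<star>\<^bsub>N\<^esub> B = B \<star>\<^bsub>N\<^esub> X \<star>\<^bsub>N\<^esub> A \<star>\<^bsub>N\<^esub> B \<longleftrightarrow>
      tmat N A' * tmat N A * tmat N B = tmat N B * tmat N X * tmat N A * tmat N B"
    using tmat_eq_iff[OF A'AB BXAB N(2)] by (simp add: mults)
  moreover have "B \<star>\<^bsub>N\<^esub> B' \<star>\<^bsub>N\<^esub> T = T \<star>\<^bsub>N\<^esub> A \<star>\<^bsub>N\<^esub> B \<star>\<^bsub>N\<^esub> X \<longleftrightarrow>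
      tmat N B * tmat N B' * adj (tmat N A) = adj (tmat N A) * tmat N A * tmat N B * tmat N X"
    using tmat_eq_iff[OF BB'T TABX N(2)] by (simp add: mults)
  ultimately show ?thesis
    using reverse_order_law[OF A'(2) B'(2) X(2)] unfolding A'_def B'_def X_def T_def by simp
qed

end
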